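(* Let $r_S$ and $r_T$ be solutions on nonempty sets $S$ and $T$, and let $(r_S,r_T,\alpha,\beta)$ be a matched product system of solutions. If $r_S$ and $r_T$ are solutions of finite order, then $$\mathrm{i}(r_S\bowtie r_T)=i\quad\text{and}\quad \mathrm{p}(r_S\bowtie r_T)=n-i,$$ where $i:=\max\{\mathrm{i}(r_S),\mathrm{i}(r_T)\}$ and $n:=\mathrm{lcm}(\mathrm{p}(r_S),\mathrm{p}(r_T))+i$.
   Context: A (set-theoretical) solution on a set $X$ is a map $r:X\times X\to X\times X$ (not necessarily bijective) with $(r\times \mathrm{id}_X)(\mathrm{id}_X\times r)(r\times \mathrm{id}_X)=(\mathrm{id}_X\times r)(r\times \mathrm{id}_X)(\mathrm{id}_X\times r)$. One writes $r(x,y)=(\lambda_x(y),\rho_y(x))$; the same letters $\lambda,\rho$ are used for the component maps of every solution. Powers $r^n$ are iterated compositions, $r^0=\mathrm{id}$. A solution $r$ is of finite order if there exist integers $i\ge 0$ and $p\ge 1$ with $r^{p+i}=r^i$. For such $r$, the index is $\mathrm{i}(r)=\min\{j\in\mathbb N_0: \exists\, l\in\mathbb N,\ l\neq j,\ r^l=r^j\}$ and the period is $\mathrm{p}(r)=\min\{k\in\mathbb N: r^{k+\mathrm{i}(r)}=r^{\mathrm{i}(r)}\}$, where $\mathbb N=\{1,2,\dots\}$ and $\mathbb N_0=\mathbb N\cup\{0\}$. Matched product system: let $r_S$, $r_T$ be solutions on $S$, $T$, and let $\alpha:T\to\mathrm{Sym}(S)$, $\beta:S\to\mathrm{Sym}(T)$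 be maps; write $\alpha_u=\alpha(u)$, $\beta_a=\beta(a)$. The quadruple $(r_S,r_T,\alpha,\beta)$ is a matched product system of solutions if for all $a,b\in S$, $u,v\in T$: (s1) $\alpha_u\alpha_v=\alpha_{\lambda_u(v)}\alpha_{\rho_v(u)}$; (s2) $\beta_a\beta_b=\beta_{\lambda_a(b)}\beta_{\rho_b(a)}$; (s3) $\rho_{\alpha_u^{-1}(b)}\alpha^{-1}_{\beta_a(u)}(a)=\alpha^{-1}_{\beta_{\rho_b(a)}\beta_b^{-1}(u)}\rho_b(a)$; (s4) $\rho_{\beta_a^{-1}(v)}\beta^{-1}_{\alpha_u(a)}(u)=\beta^{-1}_{\alpha_{\rho_v(u)}\alpha_v^{-1}(a)}\rho_v(u)$; (s5) $\lambda_a\alpha_{\beta_a^{-1}(u)}=\alpha_u\lambda_{\alpha_u^{-1}(a)}$; (s6) $\lambda_u\beta_{\alpha_u^{-1}(a)}=\beta_a\lambda_{\beta_a^{-1}(u)}$. In that case the following map on $(S\times T)\times(S\times T)$ is a solution (known), called the matched product of $r_S$ and $r_T$ and denoted $r_S\bowtie r_T$: $$(r_S\bowtie r_T)((a,u),(b,v))=\Big(\big(A,U\big),\ \big(\alpha^{-1}_{\overline U}\rho_{\alpha_{\bar u}(b)}(a),\ \beta^{-1}_{\overline A}\rho_{\beta_{\bar a}(v)}(u)\big)\Big),$$ where $\bar a=\alpha_u^{-1}(a)$, $\bar u=\beta_a^{-1}(u)$, $A=\alpha_u\lambda_{\bar a}(b)$, $U=\beta_a\lambda_{\bar u}(v)$,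 $\overline A=\alpha_U^{-1}(A)$, $\overline U=\beta_A^{-1}(U)$. *)

theory Defs imports Main begin

definition ybe_solution :: "('a \<times> 'a \<Rightarrow> 'a \<times> 'a) \<Rightarrow> bool" where
  "ybe_solution r \<longleftrightarrow>
     (let r12 = (\<lambda>(x, y, z). case r (x, y) of (x', y') \<Rightarrow> (x', y', z));
          r23 = map_prod id r
      in r12 \<circ> r23 \<circ> r12 = r23 \<circ> r12 \<circ> r23)"

text \<open>The component maps of \<open>r (x, y) = (\<lambda>\<^sub>x(y), \<rho>\<^sub>y(x))\<close>. In both, the subscript is the
  first argument after \<open>r\<close>, so \<open>rho r y x\<close> takes its arguments in the opposite order to \<open>r\<close>.\<close>

definition lam :: "('a \<times> 'a \<Rightarrow> 'a \<times> 'a) \<Rightarrow> 'a \<Rightarrow> 'a \<Rightarrow> 'a" where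
  "lam r x y = fst (r (x, y))"

definition rho :: "('a \<times> 'a \<Rightarrow> 'a \<times> 'a) \<Rightarrow> 'a \<Rightarrow> 'a \<Rightarrow> 'a" where
  "rho r y x = snd (r (x, y))"

definition finite_order :: "('a \<Rightarrow> 'a) \<Rightarrow> bool" where
  "finite_order r \<longleftrightarrow> (\<exists>i p. p \<ge> 1 \<and> r ^^ (p + i) = r ^^ i)"

text \<open>Index and period are meaningful only for maps of finite order; otherwise
  \<open>LEAST\<close> ranges over an empty set and its value is unspecified.\<close>

definition sol_index :: "('a \<Rightarrow> 'a) \<Rightarrow> nat" where
  "sol_index r = (LEAST j. \<exists>l\<ge>1. l \<noteq> j \<and> r ^^ l = r ^^ j)"

definition sol_period :: "('a \<Rightarrow> 'a) \<Rightarrow> nat" where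
  "sol_period r = (LEAST k. k \<ge> 1 \<and> r ^^ (k + sol_index r) = r ^^ sol_index r)"

definition matched_product_system ::
  "('s \<times> 's \<Rightarrow> 's \<times> 's) \<Rightarrow> ('t \<times> 't \<Rightarrow> 't \<times> 't) \<Rightarrow> ('t \<Rightarrow> 's \<Rightarrow> 's) \<Rightarrow> ('s \<Rightarrow> 't \<Rightarrow> 't) \<Rightarrow> bool" where
  "matched_product_system rS rT \<alpha> \<beta> \<longleftrightarrow>
     ybe_solution rS \<and> ybe_solution rT \<and> (\<forall>u. bij (\<alpha> u)) \<and> (\<forall>a. bij (\<beta> a)) \<and>
     (\<forall>u v. \<alpha> u \<circ> \<alpha> v = \<alpha> (lam rT u v) \<circ> \<alpha> (rho rT v u)) \<and>
     (\<forall>a b. \<beta> a \<circ> \<beta> b = \<beta> (lam rS a b) \<circ> \<beta> (rho rS b a)) \<and>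
     (\<forall>a b u. rho rS (inv (\<alpha> u) b) (inv (\<alpha> (\<beta> a u)) a)
                = inv (\<alpha> (\<beta> (rho rS b a) (inv (\<beta> b) u))) (rho rS b a)) \<and>
     (\<forall>a u v. rho rT (inv (\<beta> a) v) (inv (\<beta> (\<alpha> u a)) u)
                = inv (\<beta> (\<alpha> (rho rT v u) (inv (\<alpha> v) a))) (rho rT v u)) \<and>
     (\<forall>a u. lam rS a \<circ> \<alpha> (inv (\<beta> a) u) = \<alpha> u \<circ> lam rS (inv (\<alpha> u) a)) \<and>
     (\<forall>a u. lam rT u \<circ> \<beta> (inv (\<alpha> u) a) = \<beta> a \<circ> lam rT (inv (\<beta> a) u))"

text \<open>Here \<open>a'\<close>, \<open>u'\<close>, \<open>A'\<close>, \<open>U'\<close> stand for the barred letters.\<close>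

definition matched_product ::
  "('s \<times> 's \<Rightarrow> 's \<times> 's) \<Rightarrow> ('t \<times> 't \<Rightarrow> 't \<times> 't) \<Rightarrow> ('t \<Rightarrow> 's \<Rightarrow> 's) \<Rightarrow> ('s \<Rightarrow> 't \<Rightarrow> 't) \<Rightarrow>
   ('s \<times> 't) \<times> ('s \<times> 't) \<Rightarrow> ('s \<times> 't) \<times> ('s \<times> 't)" where
  "matched_product rS rT \<alpha> \<beta> = (\<lambda>((a, u), (b, v)).
     let a' = inv (\<alpha> u) a;
         u' = inv (\<beta> a) u;
         A = \<alpha> u (lam rS a' b);
         U = \<beta> a (lam rT u' v);
         A' = inv (\<alpha> U) A;
         U' = inv (\<beta> A) U
     in ((A, U),
         (inv (\<alpha> U') (rho rS (\<alpha> u' b) a),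
          inv (\<beta> A') (rho rT (\<beta> a' v) u))))"

end

(* The map Phi ((a, u), (b, v)) = ((a, alpha_{beta_a^{-1}(u)}(b)), (u, beta_{alpha_u^{-1}(a)}(v)))
   is a bijection which, by (s5) and (s6), conjugates the matched product to the direct product
   r_S x r_T. Hence two powers of the matched product agree iff the corresponding powers of both
   r_S and r_T agree, and index and period are determined by these coincidences. *)

theory Submission imports Defs begin

text \<open>The powers of \<open>f\<close> form a tail of length \<open>i\<close> followed by a
  cycle of length \<open>p\<close>. Recording every coincidence determines both numbers at once and
  passes easily to products and conjugates.\<close>

definition power_coincidences :: "('a \<Rightarrow> 'a) \<Rightarrow> nat \<Rightarrow> nat \<Rightarrow> bool" where
  "power_coincidences f i p \<longleftrightarrow>
     p \<ge> 1 \<and> (\<forall>l d. f ^^ (l + d) = f ^^ l \<longleftrightarrow> d = 0 \<or> i \<le> l \<and> p dvd d)"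

text \<open>Minimality of the index bounds the smaller exponent from below; minimality of the
  period, by division with remainder, forces divisibility of the gap.\<close>

lemma finite_order_coincidences:
  assumes "finite_order f"
  shows "power_coincidences f (sol_index f) (sol_period f)"
proof -
  define i p where "i = sol_index f" and "p = sol_period f"
  let ?Q = "\<lambda>j. \<exists>l\<ge>1. l \<noteq> j \<and> f ^^ l = f ^^ j"
  obtain i0 p0 where "p0 \<ge> 1" "f ^^ (p0 + i0) = f ^^ i0"
    using assms unfolding finite_order_def by blast
  then have "?Q i0" by (intro exI[of _ "p0 + i0"]) auto
  then have Qi: "?Q i" unfolding i_def sol_index_def by (rule LeastI)
  have least_i: "i \<le> j" if "?Q j" for j
    unfolding i_def sol_index_def using that by (rule Least_le)
  from Qi obtain l where l: "l \<ge> 1" "l \<noteq> i" "f ^^ l = f ^^ i" by blast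
  \<comment> \<open>If \<open>l < i\<close>, then \<open>i\<close> is a positive partner for
    \<open>l\<close>, against the minimality of \<open>i\<close>.\<close>
  have "i < l"
  proof (rule ccontr)
    assume "\<not> i < l"
    then have "?Q l" using l by (intro exI[of _ i]) auto
    then show False using least_i \<open>\<not> i < l\<close> l(2) by fastforce
  qed
  let ?R = "\<lambda>k. k \<ge> 1 \<and> f ^^ (k + i) = f ^^ i"
  have "?R (l - i)" using \<open>i < l\<close> l(3) by simp
  then have Rp: "?R p" unfolding p_def sol_period_def i_def by (rule LeastI)
  have least_p: "p \<le> k" if "?R k" for k
    unfolding p_def sol_period_def using that unfolding i_def by (rule Least_le)
  have shift: "f ^^ (m + s) = f ^^ (n + s)" if "f ^^ m = f ^^ n" for m n s
    using that by (simp add: funpow_add)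
  have periodic: "f ^^ (k + p * q) = f ^^ k" if "i \<le> k" for k q
  proof (induction q)
    case (Suc q)
    have "f ^^ (p + i + (k - i + p * q)) = f ^^ (i + (k - i + p * q))"
      using Rp by (intro shift) simp
    moreover have "p + i + (k - i + p * q) = k + p * Suc q"
      and "i + (k - i + p * q) = k + p * q" using that by auto
    ultimately show ?case using Suc by (simp only:)
  qed simp
  have "f ^^ (l + d) = f ^^ l \<longleftrightarrow> d = 0 \<or> i \<le> l \<and> p dvd d" for l d
  proof
    assume eq: "f ^^ (l + d) = f ^^ l"
    show "d = 0 \<or> i \<le> l \<and> p dvd d"
    proof (cases "d = 0")
      case False
      then have "?Q l" using eq by (intro exI[of _ "l + d"]) auto
      then have "i \<le> l" by (rule least_i)
      \<comment> \<open>Adding \<open>i + p * l - l\<close> to both exponents moves the coincidence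
        from \<open>l\<close> to \<open>i\<close>, up to the multiple \<open>p * l\<close> of the
        period; this bound keeps the subtraction from truncating.\<close>
      have "l \<le> p * l" using Rp by simp
      have "f ^^ (l + d + (i + p * l - l)) = f ^^ (l + (i + p * l - l))"
        using eq by (rule shift)
      moreover have "l + d + (i + p * l - l) = i + d + p * l"
        and "l + (i + p * l - l) = i + p * l" using \<open>l \<le> p * l\<close> by linarith+
      ultimately have "f ^^ (i + d) = f ^^ i" by (simp only: periodic le_add1 le_refl)
      moreover have "f ^^ (i + d) = f ^^ (i + d mod p)"
        using periodic[of "i + d mod p" "d div p"] by (simp add: add.assoc)
      ultimately have "f ^^ (d mod p + i) = f ^^ i" by (simp add: add.commute)
      \<comment> \<open>A nonzero remainder would be a period smaller than \<open>p\<close>.\<close>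
      moreover have "d mod p < p" using Rp by simp
      ultimately have "d mod p = 0" using least_p[of "d mod p"] by linarith
      then show ?thesis using \<open>i \<le> l\<close> by auto
    qed simp
  next
    assume "d = 0 \<or> i \<le> l \<and> p dvd d"
    then show "f ^^ (l + d) = f ^^ l" by (auto simp: periodic)
  qed
  then show ?thesis using Rp unfolding power_coincidences_def i_def p_def by blast
qed

lemma coincidences_finite_order:
  assumes "power_coincidences f i p"
  shows "finite_order f" "sol_index f = i" "sol_period f = p"
proof -
  have p: "p \<ge> 1" and C: "\<And>l d. f ^^ (l + d) = f ^^ l \<longleftrightarrow> d = 0 \<or> i \<le> l \<and> p dvd d"
    using assms unfolding power_coincidences_def by auto
  have eq: "f ^^ (p + i) = f ^^ i" using C[of i p] by (simp add: add.commute)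
  then show "finite_order f" using p unfolding finite_order_def by blast
  show index: "sol_index f = i"
    unfolding sol_index_def
  proof (rule Least_equality)
    show "\<exists>l\<ge>1. l \<noteq> i \<and> f ^^ l = f ^^ i"
      \<comment> \<open>The witness is positive even when \<open>i = 0\<close>, because
        \<open>p\<close> is.\<close>
      using p eq by (intro exI[of _ "p + i"]) auto
  next
    fix j assume "\<exists>l\<ge>1. l \<noteq> j \<and> f ^^ l = f ^^ j"
    then obtain l where l: "l \<noteq> j" "f ^^ l = f ^^ j" by blast
    show "i \<le> j"
    proof (cases "l < j")
      case True
      then show ?thesis using C[of l "j - l"] l by auto
    next
      case False
      then show ?thesis using C[of j "l - j"] l by auto
    qed
  qed
  show "sol_period f = p"
    unfolding sol_period_def index
  proof (rule Least_equality)
    fix k assume "k \<ge> 1 \<and> f ^^ (k + i) = f ^^ i"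
    then show "p \<le> k" using C[of i k] by (auto simp: add.commute intro: dvd_imp_le)
  qed (use p eq in simp)
qed

text \<open>Recovering one factor needs a point in the other; types are inhabited, which reflects
  the nonemptiness of S and T.\<close>

lemma map_prod_eq_iff: "map_prod f g = map_prod f' g' \<longleftrightarrow> f = f' \<and> g = g'"
  by (auto simp: fun_eq_iff)

lemma map_prod_funpow:
  fixes f :: "'a \<Rightarrow> 'a" and g :: "'b \<Rightarrow> 'b"
  shows "map_prod f g ^^ n = map_prod (f ^^ n) (g ^^ n)"
  by (induction n) (auto simp: fun_eq_iff)

text \<open>Both factors must coincide: the two lower bounds on \<open>l\<close> combine to the
  maximum, the two divisibilities of \<open>d\<close> to the lcm.\<close>

lemma coincidences_map_prod:
  assumes "power_coincidences f i p" "power_coincidences g j q"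
  shows "power_coincidences (map_prod f g) (max i j) (lcm p q)"
proof -
  have "lcm p q \<ge> 1" using assms by (simp add: power_coincidences_def Suc_le_eq lcm_pos_nat)
  then show ?thesis
    using assms unfolding power_coincidences_def map_prod_funpow map_prod_eq_iff by auto
qed

text \<open>Powers are conjugated by the same \<open>h\<close>, which cancels on the left by
  injectivity and on the right by surjectivity.\<close>

lemma coincidences_conjugate:
  assumes "bij h" "h \<circ> f = g \<circ> h" "power_coincidences g i p"
  shows "power_coincidences f i p"
proof -
  have conj: "h \<circ> f ^^ n = g ^^ n \<circ> h" for n
  proof (induction n)
    case (Suc n)
    have "h (f ((f ^^ n) x)) = g (h ((f ^^ n) x))" for x
      using assms(2) by (simp add: fun_eq_iff)
    then show ?case using Suc by (simp add: fun_eq_iff)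
  qed simp
  have "f ^^ m = f ^^ n \<longleftrightarrow> g ^^ m = g ^^ n" for m n
  proof -
    have "f ^^ m = f ^^ n \<longleftrightarrow> h \<circ> f ^^ m = h \<circ> f ^^ n"
      using bij_is_inj[OF assms(1)] by (simp add: fun_eq_iff inj_eq)
    also have "\<dots> \<longleftrightarrow> g ^^ m = g ^^ n"
      unfolding conj using bij_is_surj[OF assms(1)] by (metis comp_assoc comp_id surj_iff)
    finally show ?thesis .
  qed
  then show ?thesis using assms(3) unfolding power_coincidences_def by simp
qed

text \<open>This is Phi with coordinates regrouped into an S-pair and a T-pair, so that the direct
  product is literally \<open>map_prod rS rT\<close>.\<close>

definition untwist ::
  "('t \<Rightarrow> 's \<Rightarrow> 's) \<Rightarrow> ('s \<Rightarrow> 't \<Rightarrow> 't) \<Rightarrow> ('s \<times> 't) \<times> ('s \<times> 't) \<Rightarrow> ('s \<times> 's) \<times> ('t \<times> 't)" where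
  "untwist \<alpha> \<beta> = (\<lambda>((a, u), (b, v)). ((a, \<alpha> (inv (\<beta> a) u) b), (u, \<beta> (inv (\<alpha> u) a) v)))"

text \<open>The twists of \<open>b\<close> and \<open>v\<close> depend only on \<open>a\<close> and
  \<open>u\<close>, which stay fixed, so they can be undone.\<close>

lemma bij_untwist:
  assumes "\<And>u. bij (\<alpha> u)" "\<And>a. bij (\<beta> a)"
  shows "bij (untwist \<alpha> \<beta>)"
  by (rule o_bij[where g = "\<lambda>((a, y), (u, w)).
        ((a, u), (inv (\<alpha> (inv (\<beta> a) u)) y, inv (\<beta> (inv (\<alpha> u) a)) w))"])
    (auto simp: fun_eq_iff untwist_def inv_f_f bij_is_inj surj_f_inv_f bij_is_surj assms)

text \<open>By (s5) and (s6), \<open>A\<close> and \<open>U\<close> are the lambda-components at the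
  twisted arguments. In the other components, the twist taken at \<open>(A, U)\<close> cancels
  exactly the outer inverses in the matched product, leaving the rho-components.\<close>

lemma untwist_matched_product:
  assumes "matched_product_system rS rT \<alpha> \<beta>"
  shows "untwist \<alpha> \<beta> \<circ> matched_product rS rT \<alpha> \<beta> = map_prod rS rT \<circ> untwist \<alpha> \<beta>"
proof -
  have bij: "\<And>u. bij (\<alpha> u)" "\<And>a. bij (\<beta> a)"
    and s5: "\<And>a u b. \<alpha> u (lam rS (inv (\<alpha> u) a) b) = lam rS a (\<alpha> (inv (\<beta> a) u) b)"
    and s6: "\<And>a u v. \<beta> a (lam rT (inv (\<beta> a) u) v) = lam rT u (\<beta> (inv (\<alpha> u) a) v)"
    using assms unfolding matched_product_system_def by (auto simp: fun_eq_iff)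
  have pair: "r (x, y) = (lam r x y, rho r y x)" for r :: "'c \<times> 'c \<Rightarrow> 'c \<times> 'c" and x y
    by (simp add: lam_def rho_def)
  show ?thesis
    by (auto simp: fun_eq_iff untwist_def matched_product_def Let_def s5 s6 pair[of rS] pair[of rT]
        surj_f_inv_f bij_is_surj bij)
qed

theorem proposition9:
  fixes rS :: "'s \<times> 's \<Rightarrow> 's \<times> 's" and rT :: "'t \<times> 't \<Rightarrow> 't \<times> 't"
    and \<alpha> :: "'t \<Rightarrow> 's \<Rightarrow> 's" and \<beta> :: "'s \<Rightarrow> 't \<Rightarrow> 't"
  assumes "ybe_solution rS" and "ybe_solution rT"
    and "matched_product_system rS rT \<alpha> \<beta>"
    and "finite_order rS" and "finite_order rT"
  shows "let r = matched_product rS rT \<alpha> \<beta>;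
             i = max (sol_index rS) (sol_index rT);
             n = lcm (sol_period rS) (sol_period rT) + i
         in finite_order r \<and> sol_index r = i \<and> sol_period r = n - i"
proof -
  have "bij (untwist \<alpha> \<beta>)"
    using assms(3) unfolding matched_product_system_def by (intro bij_untwist) auto
  then have "power_coincidences (matched_product rS rT \<alpha> \<beta>)
      (max (sol_index rS) (sol_index rT)) (lcm (sol_period rS) (sol_period rT))"
    using untwist_matched_product[OF assms(3)]
      coincidences_map_prod[OF assms(4,5)[THEN finite_order_coincidences]]
    by (rule coincidences_conjugate)
  then show ?thesis by (simp add: Let_def coincidences_finite_order)
qed

end
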